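(* Let either $a,b\in(-1,\infty)$ with $ab>0$, or $a,b\in\mathbb{C}\setminus\{0\}$ with $b=\overline{a}$. Assume that $c$ is a positive real number such that $c>\mathrm{Re}(a+b)+1$, $\alpha\in\mathbb{C}$, and let $$f_k(z)=z+\overline{\alpha z^kF(a,b;c;z)}\quad\text{for } k=1,2.$$ (a) If $$\frac{\Gamma(c)\Gamma(c-a-b-1)}{\Gamma(c-a)\Gamma(c-b)}\,[ab+2(c-a-b-1)]\le\frac{1}{|\alpha|},$$ where $0<|\alpha|<1/2$, then $f_2\in\mathcal{S}_H^{*0}\cap\mathcal{C}_H^1$. (b) If $$\frac{\Gamma(c)\Gamma(c-a-b-1)}{\Gamma(c-a)\Gamma(c-b)}\,[ab+c-a-b-1]\le\frac{1+|\alpha|}{|\alpha|},$$ where $2|\alpha|ab\le c$, then $f(z)=z+\overline{\alpha z(F(a,b;c;z)-1)}\in\mathcal{S}_H^{*0}\cap\mathcal{C}_H^1$. (c) If $$\frac{\Gamma(c)\Gamma(c-a-b-1)}{\Gamma(c-a)\Gamma(c-b)}\,[ab+c-a-b-1]\le\frac{1}{|\alpha|},$$ where $0<|\alpha|<1$, then $f_1\in\mathcal{C}_H^1$.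
   Context: $\mathbb{D}=\{z\in\mathbb{C}:|z|<1\}$. $F(a,b;c;z)=\sum_{n=0}^\infty\frac{(a,n)(b,n)}{(c,n)(1,n)}z^n$ is the Gaussian hypergeometric function, where $(a,0)=1$ and $(a,n)=a(a+1)\cdots(a+n-1)$ for positive integers $n$. $\mathcal{H}$ is the class of complex-valued harmonic functions $f=h+\overline{g}$ in $\mathbb{D}$ with $h(z)=z+\sum_{n=2}^\infty a_nz^n$ and $g(z)=\sum_{n=1}^\infty b_nz^n$ analytic in $\mathbb{D}$. $\mathcal{S}_H$ is the class of $f\in\mathcal{H}$ that are univalent and sense-preserving (i.e. $|h'|^2-|g'|^2>0$) in $\mathbb{D}$. $\mathcal{C}_H^1=\{f\in\mathcal{S}_H:\ \mathrm{Re}\,f_z(z)>|f_{\overline z}(z)|\text{ for all } z\in\mathbb{D}\}$, where $f_z=h'$ and $f_{\overline z}=\overline{g'}$. $\mathcal{S}_H^{*0}$ is the class of $f\in\mathcal{S}_H$ with $f_{\overline z}(0)=0$ such that $f(\mathbb{D})$ is a starlike domain with respect to the origin. *)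

theory Defs
  imports "HOL-Complex_Analysis.Complex_Analysis"
begin

abbreviation unit_disc :: "complex set" where
  "unit_disc \<equiv> ball 0 1"

text \<open>The Gaussian hypergeometric function, given by its series; only arguments in the unit disc
  are meaningful.\<close>
definition hyp2F1 :: "complex \<Rightarrow> complex \<Rightarrow> complex \<Rightarrow> complex \<Rightarrow> complex" where
  "hyp2F1 a b c z =
     (\<Sum>n. pochhammer a n * pochhammer b n / (pochhammer c n * pochhammer 1 n) * z ^ n)"

text \<open>\<open>f = h + cnj g\<close> on the unit disc, with \<open>h z = z + a\<^sub>2 z\<^sup>2 + \<dots>\<close> and \<open>g z = b\<^sub>1 z + b\<^sub>2 z\<^sup>2 + \<dots>\<close>
  analytic there. On the disc, \<open>h\<close> and \<open>g\<close> are uniquely determined by \<open>f\<close> (because \<open>g 0 = 0\<close>), so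
  the existential quantifiers over \<open>h\<close> and \<open>g\<close> in the definitions below always refer to the same
  pair of functions. The values of \<open>f\<close> outside the disc are irrelevant.\<close>
definition harmonic_decomp ::
    "(complex \<Rightarrow> complex) \<Rightarrow> (complex \<Rightarrow> complex) \<Rightarrow> (complex \<Rightarrow> complex) \<Rightarrow> bool" where
  "harmonic_decomp f h g \<longleftrightarrow>
     h holomorphic_on unit_disc \<and> g holomorphic_on unit_disc \<and>
     (\<exists>a. a 0 = 0 \<and> a 1 = 1 \<and> (\<forall>z\<in>unit_disc. (\<lambda>n. a n * z ^ n) sums h z)) \<and>
     (\<exists>b. b 0 = 0 \<and> (\<forall>z\<in>unit_disc. (\<lambda>n. b n * z ^ n) sums g z)) \<and>
     (\<forall>z\<in>unit_disc. f z = h z + cnj (g z))"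

definition class_H :: "(complex \<Rightarrow> complex) set" where
  "class_H = {f. \<exists>h g. harmonic_decomp f h g}"

definition class_SH :: "(complex \<Rightarrow> complex) set" where
  "class_SH = {f \<in> class_H. inj_on f unit_disc \<and>
     (\<exists>h g. harmonic_decomp f h g \<and>
        (\<forall>z\<in>unit_disc. (cmod (deriv h z))\<^sup>2 - (cmod (deriv g z))\<^sup>2 > 0))}"

text \<open>Here \<open>deriv h z\<close> is \<open>f\<^sub>z\<close>, and \<open>cnj (deriv g z)\<close> is the derivative of \<open>f\<close> with respect to
  the conjugate variable.\<close>
definition class_CH1 :: "(complex \<Rightarrow> complex) set" where
  "class_CH1 = {f \<in> class_SH. \<exists>h g. harmonic_decomp f h g \<and>
     (\<forall>z\<in>unit_disc. Re (deriv h z) > cmod (cnj (deriv g z)))}"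

text \<open>Connectedness of the domain follows from the segment condition.\<close>
definition starlike_domain_wrt :: "complex \<Rightarrow> complex set \<Rightarrow> bool" where
  "starlike_domain_wrt p S \<longleftrightarrow> open S \<and> p \<in> S \<and> (\<forall>w\<in>S. closed_segment p w \<subseteq> S)"

definition class_SH_star0 :: "(complex \<Rightarrow> complex) set" where
  "class_SH_star0 = {f \<in> class_SH.
     (\<exists>h g. harmonic_decomp f h g \<and> cnj (deriv g 0) = 0) \<and>
     starlike_domain_wrt 0 (f ` unit_disc)}"

definition gamma_quotient :: "complex \<Rightarrow> complex \<Rightarrow> complex \<Rightarrow> complex" where
  "gamma_quotient a b c =
     Gamma c * Gamma (c - a - b - 1) / (Gamma (c - a) * Gamma (c - b))"

definition admissible_parameters :: "complex \<Rightarrow> complex \<Rightarrow> bool" where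
  "admissible_parameters a b \<longleftrightarrow>
     (a \<in> \<real> \<and> b \<in> \<real> \<and> Re a > -1 \<and> Re b > -1 \<and> Re (a * b) > 0) \<or>
     (a \<noteq> 0 \<and> b \<noteq> 0 \<and> b = cnj a)"

text \<open>For admissible parameters and real \<open>c\<close>, everything compared by an inequality is real, so
  taking real parts of such expressions loses nothing.\<close>
lemma admissible_parameters_real:
  assumes "admissible_parameters a b"
  shows "a + b \<in> \<real>" "a * b \<in> \<real>" "gamma_quotient a b (of_real c) \<in> \<real>"
proof -
  have sym: "(cnj a = a \<and> cnj b = b) \<or> (cnj a = b \<and> cnj b = a)"
    using assms by (auto simp: admissible_parameters_def Reals_cnj_iff)
  show "a + b \<in> \<real>" "a * b \<in> \<real>" "gamma_quotient a b (of_real c) \<in> \<real>"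
    using sym by (auto simp: Reals_cnj_iff gamma_quotient_def cnj_Gamma algebra_simps)
qed

end

theory Submission imports Defs begin

text \<open>In all three cases \<open>f z = z + cnj (g z)\<close> with \<open>g z = \<Sum>n. B n * z ^ n\<close>. The coefficients of
  \<open>F(a,b;c;\<cdot>)\<close> are nonnegative reals, so Gauss's formula for \<open>F(a,b;c;1)\<close> and \<open>F(a+1,b+1;c+1;1)\<close>
  turns the Gamma inequalities into \<open>(\<Sum>n. n * \<bar>B n\<bar>) \<le> 1\<close>; moreover \<open>\<bar>B 1\<bar> < 1\<close>. Hence
  \<open>K r = (\<Sum>n. n * r ^ (n - 1) * \<bar>B n\<bar>) < 1\<close> for \<open>r < 1\<close>, and \<open>K r\<close> is a Lipschitz constant of \<open>g\<close> on
  \<open>cball 0 r\<close>, which gives \<open>\<bar>g'\<bar> < 1\<close> and univalence.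

  For starlikeness, \<open>\<bar>t * z ^ n - w ^ n\<bar> \<le> n * r ^ (n - 1) * \<bar>t * z - w\<bar>\<close> holds whenever
  \<open>\<bar>z\<bar> = \<bar>w\<bar> = r\<close> and \<open>t \<ge> 0\<close>, so \<open>\<bar>t * g z - g w\<bar> \<le> K r * \<bar>t * z - w\<bar>\<close>; therefore a ray from the
  origin meets the image of the circle of radius \<open>r\<close> at most once. A segment from \<open>0\<close> towards \<open>f z\<close>
  that left \<open>f ` cball 0 r\<close>, with \<open>r = \<bar>z\<bar>\<close>, would meet it twice.

  Gauss's formula is proved by Gauss's own argument: a telescoping sum gives
  \<open>c (c-a-b) F(a,b;c;1) = (c-a) (c-b) F(a,b;c+1;1)\<close>, which is iterated while
  \<open>F(a,b;c+m;1) \<longlonglongrightarrow> 1\<close>.\<close>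

subsection \<open>Gauss's summation theorem\<close>

definition hyp_coeff :: "complex \<Rightarrow> complex \<Rightarrow> complex \<Rightarrow> nat \<Rightarrow> complex" where
  "hyp_coeff a b c n = pochhammer a n * pochhammer b n / (pochhammer c n * pochhammer 1 n)"

lemma hyp2F1_eq: "hyp2F1 a b c z = (\<Sum>n. hyp_coeff a b c n * z ^ n)"
  by (simp add: hyp2F1_def hyp_coeff_def)

lemma hyp_coeff_0 [simp]: "hyp_coeff a b c 0 = 1"
  by (simp add: hyp_coeff_def)

lemma pochhammer_neq_0: "(c :: complex) \<notin> \<int>\<^sub>\<le>\<^sub>0 \<Longrightarrow> pochhammer c n \<noteq> 0"
  using pochhammer_eq_0_imp_nonpos_Int by blast

lemma plus_of_nat_neq_0: "(c :: complex) \<notin> \<int>\<^sub>\<le>\<^sub>0 \<Longrightarrow> c + of_nat n \<noteq> 0"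
  by (metis plus_of_nat_eq_0_imp)

lemma Re_pos_imp_not_nonpos_Int: "Re z > 0 \<Longrightarrow> z \<notin> \<int>\<^sub>\<le>\<^sub>0"
  by (auto simp: nonpos_Ints_def)

text \<open>Euler's limit formula solved for the Pochhammer symbol: \<open>rGamma_series z\<close>
  converges to \<open>rGamma z\<close>, so the other factor carries the growth. Its index
  \<open>Suc n\<close> is why later limits run along successors.\<close>

lemma pochhammer_eq_rGamma_series:
  "n > 0 \<Longrightarrow> pochhammer (z :: complex) (Suc n) =
     rGamma_series z n * (fact n * exp (z * of_real (ln (of_nat n))))"
  by (simp add: rGamma_series_def)

lemma hyp_coeff_Suc:
  assumes "c \<notin> \<int>\<^sub>\<le>\<^sub>0"
  shows "of_nat (Suc n) * hyp_coeff a b c (Suc n) * (c + of_nat n) =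
           hyp_coeff a b c n * (a + of_nat n) * (b + of_nat n)"
proof -
  have *: "s * (p * x * (q * y) / (r * u * (f * s))) * u = p * q / (r * f) * x * y"
    if "s \<noteq> 0" "u \<noteq> 0" for s p x q y r u f :: complex
    using that by (simp add: field_simps)
  show ?thesis
    unfolding hyp_coeff_def pochhammer_fact[symmetric] fact_Suc pochhammer_Suc of_nat_Suc
    by (rule *) (use plus_of_nat_neq_0[OF assms, of n] of_nat_neq_0[where 'a = complex, of n] in simp_all)
qed

section \<open>Growth and summability of the coefficients\<close>

text \<open>By Euler's formula the Pochhammer quotient is a convergent, hence bounded, sequence
  times a power of \<open>n\<close>. The factor \<open>of_nat (Suc n)\<close> reduces
  \<open>fact (Suc n)\<close> to \<open>fact n\<close>, so all factorials cancel.\<close>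

lemma hyp_coeff_bound:
  assumes "c \<notin> \<int>\<^sub>\<le>\<^sub>0"
  obtains M where "\<And>n. n > 0 \<Longrightarrow>
    cmod (of_nat (Suc n) * hyp_coeff a b c (Suc n)) \<le> M * real n powr Re (a + b - c)"
proof -
  define X where "X n = rGamma_series a n * rGamma_series b n / rGamma_series c n" for n
  have "X \<longlonglongrightarrow> rGamma a * rGamma b / rGamma c"
    unfolding X_def[abs_def] using assms by (intro tendsto_divide tendsto_mult rGamma_series_LIMSEQ) (simp add: rGamma_eq_zero_iff)
  then have "Bseq X"
    by (intro convergent_imp_Bseq convergentI)
  then obtain M where M: "\<And>n. cmod (X n) \<le> M"
    unfolding Bseq_def by blast
  show thesis
  proof
    fix n :: nat assume n: "n > 0"
    have "of_nat (Suc n) * hyp_coeff a b c (Suc n) = X n * exp ((a + b - c) * of_real (ln (real n)))"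
      using n pochhammer_neq_0[OF assms, of "Suc n"] 
      unfolding hyp_coeff_def X_def pochhammer_fact[symmetric]
      by (simp add: pochhammer_eq_rGamma_series ring_distribs exp_add exp_diff divide_simps
               del: of_nat_Suc)
    also have "cmod \<dots> = cmod (X n) * real n powr Re (a + b - c)"
      using n by (simp add: norm_mult powr_def)
    also have "\<dots> \<le> M * real n powr Re (a + b - c)"
      using M by (intro mult_right_mono) auto
    finally show "cmod (of_nat (Suc n) * hyp_coeff a b c (Suc n)) \<le> M * real n powr Re (a + b - c)" .
  qed
qed

lemma summable_norm_hyp_coeff:
  assumes "c \<notin> \<int>\<^sub>\<le>\<^sub>0" "Re c > Re (a + b)"
  shows "summable (\<lambda>n. cmod (hyp_coeff a b c n))"
proof -
  obtain M where M: "\<And>n. n > 0 \<Longrightarrow>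
    cmod (of_nat (Suc n) * hyp_coeff a b c (Suc n)) \<le> M * real n powr Re (a + b - c)"
    using hyp_coeff_bound[OF assms(1)] by blast
  have "summable (\<lambda>n. M * real n powr (Re (a + b - c) - 1))"
    using assms by (intro summable_mult) (simp add: summable_real_powr_iff)
  then have "summable (\<lambda>n. cmod (hyp_coeff a b c (Suc n)))"
  proof (rule summable_comparison_test[rotated], intro exI allI impI)
    fix n :: nat assume n: "n \<ge> 1"
    have "real n * cmod (hyp_coeff a b c (Suc n)) \<le> cmod (of_nat (Suc n) * hyp_coeff a b c (Suc n))"
      unfolding norm_mult norm_of_nat by (intro mult_right_mono) auto
    also have "\<dots> \<le> M * real n powr Re (a + b - c)"
      using M n by simp
    finally show "norm (cmod (hyp_coeff a b c (Suc n))) \<le> M * real n powr (Re (a + b - c) - 1)"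
      using n by (simp add: powr_diff pos_le_divide_eq mult.commute del: minus_complex.sel plus_complex.sel)
  qed
  then show ?thesis
    using summable_Suc_iff[of "\<lambda>n. cmod (hyp_coeff a b c n)"] by blast
qed

text \<open>The exponent in \<open>hyp_coeff_bound\<close> is negative here. This removes the
  boundary term of the telescoping sum in \<open>hyp2F1_1_contiguous\<close>.\<close>

lemma mult_hyp_coeff_tendsto_0:
  assumes "c \<notin> \<int>\<^sub>\<le>\<^sub>0" "Re c > Re (a + b)"
  shows "(\<lambda>n. of_nat n * hyp_coeff a b c n) \<longlonglongrightarrow> 0"
proof -
  obtain M where M: "\<And>n. n > 0 \<Longrightarrow>
    cmod (of_nat (Suc n) * hyp_coeff a b c (Suc n)) \<le> M * real n powr Re (a + b - c)"
    using hyp_coeff_bound[OF assms(1)] by blast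
  have "(\<lambda>n. real n powr Re (a + b - c)) \<longlonglongrightarrow> 0"
    using assms by (intro tendsto_neg_powr filterlim_real_sequentially) auto
  then have "(\<lambda>n. M * real n powr Re (a + b - c)) \<longlonglongrightarrow> 0"
    by (rule tendsto_mult_right_zero)
  then have "(\<lambda>n. of_nat (Suc n) * hyp_coeff a b c (Suc n)) \<longlonglongrightarrow> 0"
    by (rule Lim_null_comparison[rotated])
       (use M in \<open>auto intro!: eventually_mono[OF eventually_gt_at_top[of 0]] simp del: of_nat_Suc\<close>)
  then show ?thesis
    by (rule LIMSEQ_imp_Suc)
qed

section \<open>Gauss's contiguous relation at 1 and its iteration\<close>

text \<open>Every term is a multiple of \<open>hyp_coeff a b c n\<close>; what remains is the
  identity \<open>(c - a - b) * (c + n) - (c - a) * (c - b) = n * (c + n) - (a + n) * (b +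
  n)\<close>.\<close>

lemma hyp_coeff_contiguous:
  assumes "c \<notin> \<int>\<^sub>\<le>\<^sub>0"
  shows "c * (c - a - b) * hyp_coeff a b c n - (c - a) * (c - b) * hyp_coeff a b (c + 1) n =
           c * (of_nat n * hyp_coeff a b c n - of_nat (Suc n) * hyp_coeff a b c (Suc n))"
proof -
  have c: "c \<noteq> 0" "c + of_nat n \<noteq> 0"
    using plus_of_nat_neq_0[OF assms, of 0] plus_of_nat_neq_0[OF assms, of n] by auto
  have "c * pochhammer (c + 1) n = pochhammer c n * (c + of_nat n)"
    by (metis pochhammer_Suc pochhammer_rec)
  then have p: "pochhammer (c + 1) n = pochhammer c n * (c + of_nat n) / c"
    using c by (simp add: field_simps)
  have B: "hyp_coeff a b (c + 1) n = hyp_coeff a b c n * c / (c + of_nat n)"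
    using c unfolding hyp_coeff_def p by simp
  have C: "of_nat (Suc n) * hyp_coeff a b c (Suc n) =
      hyp_coeff a b c n * (a + of_nat n) * (b + of_nat n) / (c + of_nat n)"
    using hyp_coeff_Suc[OF assms, of n a b] c by (simp add: field_simps del: of_nat_Suc)
  show ?thesis
    unfolding B C using c by (simp add: divide_simps) (simp add: algebra_simps)
qed

lemma hyp2F1_1_contiguous:
  assumes "c \<notin> \<int>\<^sub>\<le>\<^sub>0" "Re c > Re (a + b)"
  shows "c * (c - a - b) * hyp2F1 a b c 1 = (c - a) * (c - b) * hyp2F1 a b (c + 1) 1"
proof -
  have c1: "c + 1 \<notin> \<int>\<^sub>\<le>\<^sub>0"
    using assms(1) by (metis add_diff_cancel_right' nonpos_Ints_diff_Nats Nats_1)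
  have s: "hyp_coeff a b c sums hyp2F1 a b c 1" "hyp_coeff a b (c + 1) sums hyp2F1 a b (c + 1) 1"
    using summable_norm_cancel[OF summable_norm_hyp_coeff[OF assms]]
      summable_norm_cancel[OF summable_norm_hyp_coeff[OF c1, of a b]] assms(2)
    by (simp_all add: hyp2F1_eq summable_sums)
  \<comment> \<open>Both ends of the telescoping sum vanish: the first through its factor 0, the
    last in the limit.\<close>
  have "(\<lambda>n. c * (of_nat n * hyp_coeff a b c n - of_nat (Suc n) * hyp_coeff a b c (Suc n)))
          sums (c * (of_nat 0 * hyp_coeff a b c 0 - 0))"
    by (intro sums_mult telescope_sums' mult_hyp_coeff_tendsto_0 assms)
  moreover have "(\<lambda>n. c * (of_nat n * hyp_coeff a b c n - of_nat (Suc n) * hyp_coeff a b c (Suc n)))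
          sums (c * (c - a - b) * hyp2F1 a b c 1 - (c - a) * (c - b) * hyp2F1 a b (c + 1) 1)"
    unfolding hyp_coeff_contiguous[OF assms(1), symmetric]
    by (intro sums_diff sums_mult s)
  ultimately show ?thesis
    using sums_unique2 by fastforce
qed

lemma plus_of_nat_not_nonpos_Int: "(c :: complex) \<notin> \<int>\<^sub>\<le>\<^sub>0 \<Longrightarrow> c + of_nat n \<notin> \<int>\<^sub>\<le>\<^sub>0"
  by (metis add_diff_cancel_right' nonpos_Ints_diff_Nats of_nat_in_Nats)

text \<open>Iterates the contiguous relation. The divisions are legitimate because
  \<open>c - a - b\<close> has positive real part and \<open>c\<close> is not a nonpositive
  integer.\<close>

lemma hyp2F1_1_shift:
  assumes "c \<notin> \<int>\<^sub>\<le>\<^sub>0" "Re c > Re (a + b)"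
  shows "hyp2F1 a b c 1 = pochhammer (c - a) m * pochhammer (c - b) m /
           (pochhammer c m * pochhammer (c - a - b) m) * hyp2F1 a b (c + of_nat m) 1"
proof (induction m)
  case (Suc m)
  have d: "c - a - b \<notin> \<int>\<^sub>\<le>\<^sub>0"
    using assms by (intro Re_pos_imp_not_nonpos_Int) auto
  have nz: "c + of_nat m \<noteq> 0" "c - a - b + of_nat m \<noteq> 0"
    using assms(1) d plus_of_nat_neq_0 by blast+
  have "(c + of_nat m) * (c + of_nat m - a - b) * hyp2F1 a b (c + of_nat m) 1 =
        (c + of_nat m - a) * (c + of_nat m - b) * hyp2F1 a b (c + of_nat m + 1) 1"
    using assms by (intro hyp2F1_1_contiguous plus_of_nat_not_nonpos_Int) auto
  moreover have "c + of_nat m - a - b = c - a - b + of_nat m" "c + of_nat m - a = c - a + of_nat m"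
      "c + of_nat m - b = c - b + of_nat m" "c + of_nat m + 1 = c + of_nat (Suc m)"
    by simp_all
  ultimately have "(c + of_nat m) * (c - a - b + of_nat m) * hyp2F1 a b (c + of_nat m) 1 =
        (c - a + of_nat m) * (c - b + of_nat m) * hyp2F1 a b (c + of_nat (Suc m)) 1"
    by (simp only:)
  moreover have "x = v / u * y" if "u * x = v * y" "u \<noteq> 0" for u v x y :: complex
    using that by (simp add: field_simps)
  ultimately have "hyp2F1 a b (c + of_nat m) 1 = (c - a + of_nat m) * (c - b + of_nat m) /
        ((c + of_nat m) * (c - a - b + of_nat m)) * hyp2F1 a b (c + of_nat (Suc m)) 1"
    using nz by (simp only: mult_eq_0_iff de_Morgan_disj simp_thms)
  then show ?case
    unfolding Suc.IH by (simp add: pochhammer_Suc mult_ac)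
qed auto

section \<open>The limit of the shifted series and Gauss's formula\<close>

lemma pochhammer_Re_le_norm:
  assumes "Re z > 0"
  shows "pochhammer (Re z) n \<le> cmod (pochhammer z n)"
proof (induction n)
  case (Suc n)
  have "Re z + real n \<le> cmod (z + of_nat n)"
    using complex_Re_le_cmod[of "z + of_nat n"] by simp
  then show ?case
    unfolding pochhammer_Suc norm_mult using assms Suc by (intro mult_mono) auto
qed auto

lemma pochhammer_mono_real:
  assumes "0 < x" "x \<le> (y :: real)"
  shows "pochhammer x n \<le> pochhammer y n"
  unfolding pochhammer_prod using assms by (intro prod_mono) auto

text \<open>Tannery's theorem: the coefficients with lower parameter \<open>c + of_nat m\<close> are
  dominated by those of a fixed convergent series, and all but the zeroth tend to 0.\<close>

lemma hyp2F1_1_tendsto: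
  "(\<lambda>m. hyp2F1 a b (c + of_nat m) 1) \<longlonglongrightarrow> 1"
proof -
  \<comment> \<open>Chosen so that \<open>x0 = Re c + m0\<close> is positive and exceeds
    \<open>Re (a + b)\<close>; the series with lower parameter \<open>x0\<close> is then the
    summable majorant.\<close>
  obtain m0 :: nat where "real m0 > max (- Re c) (Re (a + b) - Re c)"
    using reals_Archimedean2 by blast
  define x0 where "x0 = Re c + m0"
  have x0: "x0 > 0" "x0 > Re (a + b)"
    using \<open>real m0 > _\<close> by (auto simp: x0_def)
  have bound: "cmod (hyp_coeff a b (c + of_nat m) (Suc k)) \<le>
      cmod (hyp_coeff a b (of_real x0) (Suc k)) * (x0 / (Re c + real m))" if "m \<ge> m0" for m k
  proof -
    have x: "x0 \<le> Re c + real m"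
      using that by (simp add: x0_def)
    \<comment> \<open>Splitting off the first factor of each Pochhammer symbol leaves the decaying
      ratio \<open>x0 / (Re c + real m)\<close>; the other factors are compared by
      monotonicity.\<close>
    have "(Re c + real m) * pochhammer x0 (Suc k) \<le> x0 * ((Re c + real m) * pochhammer (Re c + real m + 1) k)"
      unfolding pochhammer_rec[of x0] using x x0
      by (simp add: pochhammer_mono_real mult_left_mono)
    also have "\<dots> \<le> x0 * cmod (pochhammer (c + of_nat m) (Suc k))"
      using pochhammer_Re_le_norm[of "c + of_nat m" "Suc k"] x x0
      by (simp add: pochhammer_rec[of "Re c + real m"])
    finally have le: "(Re c + real m) / x0 * pochhammer x0 (Suc k) \<le> cmod (pochhammer (c + of_nat m) (Suc k))"
      using x0 by (simp add: field_simps)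
    have pos: "(Re c + real m) / x0 * pochhammer x0 (Suc k) > 0"
      using x x0 by (intro mult_pos_pos divide_pos_pos pochhammer_pos) auto
    have eq: "cmod (pochhammer (of_real x0) (Suc k)) = pochhammer x0 (Suc k)"
      using pochhammer_pos[OF x0(1), of "Suc k"] by (simp add: pochhammer_of_real del: of_real_mult)
    have "cmod (hyp_coeff a b (c + of_nat m) (Suc k)) =
        cmod (pochhammer a (Suc k)) * cmod (pochhammer b (Suc k)) / cmod (pochhammer 1 (Suc k))
          / cmod (pochhammer (c + of_nat m) (Suc k))"
      by (simp add: hyp_coeff_def norm_mult norm_divide)
    also have "\<dots> \<le> cmod (pochhammer a (Suc k)) * cmod (pochhammer b (Suc k)) / cmod (pochhammer 1 (Suc k))
          / ((Re c + real m) / x0 * pochhammer x0 (Suc k))"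
      using le pos by (intro divide_left_mono mult_pos_pos[OF order_less_le_trans[OF pos le] pos]) auto
    also have "\<dots> = cmod (hyp_coeff a b (of_real x0) (Suc k)) * (x0 / (Re c + real m))"
      by (simp add: hyp_coeff_def norm_mult norm_divide eq)
    finally show ?thesis .
  qed
  have "((\<lambda>m. \<Sum>k. hyp_coeff a b (c + of_nat m) k) \<longlonglongrightarrow> (\<Sum>k. if k = 0 then 1 else 0))"
  proof (intro tannerys_theorem[THEN conjunct2, THEN conjunct2] allI)
    show "summable (\<lambda>k. cmod (hyp_coeff a b (of_real x0) k))"
      using x0 by (intro summable_norm_hyp_coeff Re_pos_imp_not_nonpos_Int) auto
    have "eventually (\<lambda>(k,m). (k::nat) \<ge> 0 \<and> m \<ge> m0) (at_top \<times>\<^sub>F at_top)"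
      using eventually_prodI[OF eventually_ge_at_top[of "0::nat"] eventually_ge_at_top[of m0]]
      by (simp add: case_prod_unfold)
    then show "eventually (\<lambda>(k,m). cmod (hyp_coeff a b (c + of_nat m) k) \<le> cmod (hyp_coeff a b (of_real x0) k))
                (at_top \<times>\<^sub>F at_top)"
    proof (rule eventually_mono, clarify)
      fix k m :: nat assume m: "m \<ge> m0"
      show "cmod (hyp_coeff a b (c + of_nat m) k) \<le> cmod (hyp_coeff a b (of_real x0) k)"
      proof (cases k)
        case (Suc j)
        have "x0 / (Re c + real m) \<le> 1"
          using m x0 by (simp add: x0_def field_simps)
        then show ?thesis
          using bound[OF m, of j] Suc
          by (meson mult_left_le norm_ge_zero order_trans)
      qed auto
    qed
  next
    fix k :: nat
    show "(\<lambda>m. hyp_coeff a b (c + of_nat m) k) \<longlonglongrightarrow> (if k = 0 then 1 else 0)"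
    proof (cases k)
      case (Suc j)
      have "(\<lambda>m. x0 / (Re c + real m)) \<longlonglongrightarrow> 0"
        by real_asymp
      then have "(\<lambda>m. cmod (hyp_coeff a b (of_real x0) (Suc j)) * (x0 / (Re c + real m))) \<longlonglongrightarrow> 0"
        by (rule tendsto_mult_right_zero)
      then have "(\<lambda>m. hyp_coeff a b (c + of_nat m) (Suc j)) \<longlonglongrightarrow> 0"
        by (rule Lim_null_comparison[rotated])
           (use bound in \<open>auto intro!: eventually_mono[OF eventually_ge_at_top[of m0]]\<close>)
      then show ?thesis
        using Suc by simp
    qed auto
  qed auto
  moreover have "(\<Sum>k::nat. if k = 0 then 1 else 0 :: complex) = 1"
    by (subst suminf_finite[of "{0}"]) auto
  ultimately show ?thesis
    by (simp add: hyp2F1_eq)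
qed

theorem Gauss_hyp2F1_1:
  assumes "c \<notin> \<int>\<^sub>\<le>\<^sub>0" "Re c > Re (a + b)"
  shows "hyp2F1 a b c 1 = Gamma c * Gamma (c - a - b) / (Gamma (c - a) * Gamma (c - b))"
proof -
  have d: "c - a - b \<notin> \<int>\<^sub>\<le>\<^sub>0"
    using assms by (intro Re_pos_imp_not_nonpos_Int) auto
  define G where "G m = pochhammer (c - a) m * pochhammer (c - b) m /
           (pochhammer c m * pochhammer (c - a - b) m)" for m
  have "(\<lambda>m. rGamma_series (c - a) m * rGamma_series (c - b) m /
          (rGamma_series c m * rGamma_series (c - a - b) m)) \<longlonglongrightarrow>
        rGamma (c - a) * rGamma (c - b) / (rGamma c * rGamma (c - a - b))"
    using assms d by (intro tendsto_divide tendsto_mult rGamma_series_LIMSEQ) (auto simp: rGamma_eq_zero_iff)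
  then have G: "(\<lambda>m. G (Suc m)) \<longlonglongrightarrow> rGamma (c - a) * rGamma (c - b) / (rGamma c * rGamma (c - a - b))"
  proof (rule Lim_transform_eventually)
    show "eventually (\<lambda>m. rGamma_series (c - a) m * rGamma_series (c - b) m /
          (rGamma_series c m * rGamma_series (c - a - b) m) = G (Suc m)) sequentially"
      using eventually_gt_at_top[of 0]
    proof eventually_elim
      case (elim m)
      \<comment> \<open>The powers of \<open>m\<close> cancel because
        \<open>(c - a) + (c - b) = c + (c - a - b)\<close>.\<close>
      have *: "exp ((c - a) * of_real (ln (real m))) * exp ((c - b) * of_real (ln (real m))) =
            exp (c * of_real (ln (real m))) * exp ((c - a - b) * of_real (ln (real m)))"
        unfolding exp_add[symmetric] by (simp add: algebra_simps)
      have **: "x * y / (u * v) = (x * (fact m * p)) * (y * (fact m * q)) / ((u * (fact m * r)) * (v * (fact m * s)))"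
        if "p * q = r * s" "r \<noteq> 0" "s \<noteq> 0" for x y u v p q r s :: complex
      proof -
        have "(x * (fact m * p)) * (y * (fact m * q)) / ((u * (fact m * r)) * (v * (fact m * s))) =
              (x * y) * (fact m * fact m * (p * q)) / ((u * v) * (fact m * fact m * (r * s)))"
          by (simp add: mult_ac)
        also have "\<dots> = x * y / (u * v)"
          unfolding that(1) using that(2,3) by (intro nonzero_mult_divide_mult_cancel_right) auto
        finally show ?thesis ..
      qed
      show ?case
        unfolding G_def pochhammer_eq_rGamma_series[OF elim] by (rule **[OF *]) auto
    qed
  qed
  have "(\<lambda>m. G (Suc m) * hyp2F1 a b (c + of_nat (Suc m)) 1) \<longlonglongrightarrow>
      rGamma (c - a) * rGamma (c - b) / (rGamma c * rGamma (c - a - b)) * 1"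
    by (intro tendsto_mult G LIMSEQ_Suc[OF hyp2F1_1_tendsto])
  \<comment> \<open>The sequence is constant by \<open>hyp2F1_1_shift\<close>, so it equals its
    limit.\<close>
  moreover have "G (Suc m) * hyp2F1 a b (c + of_nat (Suc m)) 1 = hyp2F1 a b c 1" for m
    unfolding G_def using hyp2F1_1_shift[OF assms] by metis
  ultimately have "hyp2F1 a b c 1 = rGamma (c - a) * rGamma (c - b) / (rGamma c * rGamma (c - a - b))"
    by (simp only: LIMSEQ_const_iff mult_1_right)
  \<comment> \<open>Poles of \<open>Gamma (c - a)\<close> or \<open>Gamma (c - b)\<close> are
    covered: there \<open>rGamma\<close> is 0, and so is the quotient, by the conventions for
    \<open>Gamma\<close> at poles and division by 0.\<close>
  then show ?thesis
    by (simp add: rGamma_inverse_Gamma divide_inverse mult_ac)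
qed

subsection \<open>Harmonic mappings with small coefficients\<close>

lemma norm_power_diff_le:
  fixes z w :: complex
  assumes "cmod z \<le> r" "cmod w \<le> r"
  shows "cmod (z ^ Suc n - w ^ Suc n) \<le> real (Suc n) * r ^ n * cmod (z - w)"
proof (induction n)
  case (Suc n)
  have r: "r \<ge> 0"
    using assms norm_ge_zero order_trans by blast
  have "z ^ Suc (Suc n) - w ^ Suc (Suc n) = z * (z ^ Suc n - w ^ Suc n) + (z - w) * w ^ Suc n"
    by (simp add: algebra_simps)
  also have "cmod \<dots> \<le> cmod z * cmod (z ^ Suc n - w ^ Suc n) + cmod (z - w) * cmod w ^ Suc n"
    by (metis norm_mult norm_power norm_triangle_ineq)
  also have "\<dots> \<le> r * (real (Suc n) * r ^ n * cmod (z - w)) + cmod (z - w) * r ^ Suc n"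
    using assms r Suc by (intro add_mono mult_mono power_mono mult_left_mono) auto
  also have "\<dots> = real (Suc (Suc n)) * r ^ Suc n * cmod (z - w)"
    by (simp add: algebra_simps)
  finally show ?case .
qed auto

text \<open>The law of cosines, arranged to separate a radial part from an angular part.\<close>

lemma norm_scaled_diff_sq:
  fixes u v :: complex and t :: real
  assumes "cmod u = \<rho>" "cmod v = \<rho>"
  shows "(cmod (of_real t * u - v))\<^sup>2 = (1 - t)\<^sup>2 * \<rho>\<^sup>2 + t * (cmod (u - v))\<^sup>2"
proof -
  have "(Re u)\<^sup>2 + (Im u)\<^sup>2 = \<rho>\<^sup>2" "(Re v)\<^sup>2 + (Im v)\<^sup>2 = \<rho>\<^sup>2"
    using assms cmod_power2 by metis+
  then have "(t * Re u - Re v)\<^sup>2 + (t * Im u - Im v)\<^sup>2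
     = (1 - t)\<^sup>2 * \<rho>\<^sup>2 + t * ((Re u - Re v)\<^sup>2 + (Im u - Im v)\<^sup>2)"
    by algebra
  then show ?thesis
    by (simp add: cmod_power2)
qed

text \<open>\<open>norm_scaled_diff_sq\<close> is applied to the powers and to \<open>z\<close>,
  \<open>w\<close> themselves. The angular part obeys \<open>norm_power_diff_le\<close>, weighted by
  \<open>t \<ge> 0\<close>; the radial part only gains from the factor
  \<open>(Suc n)^2\<close>.\<close>

lemma norm_scaled_power_diff_le:
  fixes z w :: complex and t :: real
  assumes "cmod z = r" "cmod w = r" "t \<ge> 0"
  shows "cmod (of_real t * z ^ Suc n - w ^ Suc n) \<le> real (Suc n) * r ^ n * cmod (of_real t * z - w)"
proof (rule power2_le_imp_le)
  have r: "r \<ge> 0"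
    using assms by auto
  have "(cmod (of_real t * z ^ Suc n - w ^ Suc n))\<^sup>2 =
      (1 - t)\<^sup>2 * (r ^ Suc n)\<^sup>2 + t * (cmod (z ^ Suc n - w ^ Suc n))\<^sup>2"
    using assms by (intro norm_scaled_diff_sq) (simp_all add: norm_power norm_mult)
  also have "\<dots> \<le> (real (Suc n))\<^sup>2 * ((1 - t)\<^sup>2 * (r ^ Suc n)\<^sup>2) + t * (real (Suc n) * r ^ n * cmod (z - w))\<^sup>2"
  proof (intro add_mono mult_left_mono power_mono norm_power_diff_le)
    show "(1 - t)\<^sup>2 * (r ^ Suc n)\<^sup>2 \<le> (real (Suc n))\<^sup>2 * ((1 - t)\<^sup>2 * (r ^ Suc n)\<^sup>2)"
      using mult_right_mono[of 1 "(real (Suc n))\<^sup>2" "(1 - t)\<^sup>2 * (r ^ Suc n)\<^sup>2"] by simp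
  qed (use assms in auto)
  also have "\<dots> = (real (Suc n) * r ^ n)\<^sup>2 * ((1 - t)\<^sup>2 * r\<^sup>2 + t * (cmod (z - w))\<^sup>2)"
    by (simp add: algebra_simps del: of_nat_Suc)
  also have "(1 - t)\<^sup>2 * r\<^sup>2 + t * (cmod (z - w))\<^sup>2 = (cmod (of_real t * z - w))\<^sup>2"
    using assms by (intro norm_scaled_diff_sq[symmetric])
  finally show "(cmod (of_real t * z ^ Suc n - w ^ Suc n))\<^sup>2 \<le>
      (real (Suc n) * r ^ n * cmod (of_real t * z - w))\<^sup>2"
    by (simp add: power_mult_distrib del: of_nat_Suc)
  show "0 \<le> real (Suc n) * r ^ n * cmod (of_real t * z - w)"
    using r by simp
qed

section \<open>Injectivity and starlikeness under the coefficient condition\<close>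

text \<open>Since \<open>sum_B\<close> allows equality, the strict bound \<open>B_1\<close> is what
  rules out degenerate maps such as \<open>z + cnj z\<close>.\<close>

locale harmonic_small_coeffs =
  fixes B :: "nat \<Rightarrow> complex"
  assumes B_0: "B 0 = 0"
    and B_1: "cmod (B 1) < 1"
    and summable_B: "summable (\<lambda>n. real n * cmod (B n))"
    and sum_B: "(\<Sum>n. real n * cmod (B n)) \<le> 1"
begin

definition g :: "complex \<Rightarrow> complex" where
  "g z = (\<Sum>n. B n * z ^ n)"

definition f :: "complex \<Rightarrow> complex" where
  "f z = z + cnj (g z)"

text \<open>The derivative at \<open>r\<close> of the majorant series with coefficients
  \<open>cmod (B n)\<close>. At \<open>n = 0\<close> the truncated exponent is harmless because of
  the factor \<open>real n\<close>.\<close>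

definition K :: "real \<Rightarrow> real" where
  "K r = (\<Sum>n. real n * r ^ (n - 1) * cmod (B n))"

lemma summable_K:
  assumes "0 \<le> r" "r \<le> 1"
  shows "summable (\<lambda>n. real n * r ^ (n - 1) * cmod (B n))"
  using summable_B
  by (rule summable_comparison_test[rotated], intro exI allI impI)
     (use assms in \<open>auto intro!: mult_right_mono mult_left_le simp: power_le_one\<close>)

text \<open>As \<open>r ^ (n - 1) \<le> r\<close> for \<open>n \<ge> 2\<close>, \<open>K r\<close>
  is at most a convex combination, with weights \<open>r\<close> and \<open>1 - r\<close>, of the
  full sum and \<open>cmod (B 1)\<close>. The weight \<open>1 - r\<close> is positive and
  \<open>cmod (B 1) < 1\<close>.\<close>

lemma K_less_1:
  assumes "0 \<le> r" "r < 1"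
  shows "K r < 1"
proof -
  have s: "(\<lambda>n. if n = 1 then (1 - r) * cmod (B 1) else 0) sums ((1 - r) * cmod (B 1))"
    using sums_single[of 1 "\<lambda>_. (1 - r) * cmod (B 1)"] by simp
  have "K r \<le> (\<Sum>n. r * (real n * cmod (B n)) + (if n = 1 then (1 - r) * cmod (B 1) else 0))"
    unfolding K_def
  proof (intro suminf_le summable_add summable_mult summable_B sums_summable[OF s] summable_K)
    fix n
    consider "n = 0" | "n = 1" | k where "n = Suc (Suc k)"
      by (metis One_nat_def not0_implies_Suc)
    then show "real n * r ^ (n - 1) * cmod (B n)
            \<le> r * (real n * cmod (B n)) + (if n = 1 then (1 - r) * cmod (B 1) else 0)"
    proof cases
      case 3
      have "r ^ Suc k \<le> r"
        using assms by (simp add: mult_left_le power_le_one)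
      then have "r ^ Suc k * (real n * cmod (B n)) \<le> r * (real n * cmod (B n))"
        by (intro mult_right_mono) auto
      then show ?thesis
        using 3 by (simp add: mult_ac)
    qed (auto simp: algebra_simps)
  qed (use assms in auto)
  also have "\<dots> = r * (\<Sum>n. real n * cmod (B n)) + (1 - r) * cmod (B 1)"
    using sums_add[OF sums_mult[OF summable_sums[OF summable_B]] s] by (simp add: sums_iff)
  also have "\<dots> \<le> r * 1 + (1 - r) * cmod (B 1)"
    using assms sum_B by (intro add_right_mono mult_left_mono) auto
  also have "\<dots> < r * 1 + (1 - r) * 1"
    using assms B_1 by (intro add_strict_left_mono mult_strict_left_mono) auto
  finally show ?thesis
    by simp
qed

lemma summable_g:
  assumes "cmod z \<le> 1"
  shows "summable (\<lambda>n. B n * z ^ n)"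
proof (rule summable_comparison_test[OF _ summable_B], intro exI allI impI)
  fix n :: nat assume "n \<ge> 1"
  have "cmod (B n) * cmod z ^ n \<le> cmod (B n) * real n"
    using assms \<open>n \<ge> 1\<close> by (intro mult_left_mono order_trans[OF power_le_one]) auto
  then show "norm (B n * z ^ n) \<le> real n * cmod (B n)"
    by (simp add: norm_mult norm_power mult.commute)
qed

text \<open>Termwise estimate serving two purposes: \<open>t = 1\<close> gives the Lipschitz bound,
  real \<open>t \<ge> 0\<close> the comparison along rays. The constant term drops out by
  \<open>B_0\<close>.\<close>

lemma g_diff_le:
  assumes "cmod z \<le> 1" "cmod w \<le> 1" "0 \<le> r" "r \<le> 1"
    and "\<And>n. cmod (t * z ^ Suc n - w ^ Suc n) \<le> real (Suc n) * r ^ n * d"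
  shows "cmod (t * g z - g w) \<le> K r * d"
proof -
  have sm: "summable (\<lambda>n. real n * r ^ (n - 1) * cmod (B n) * d)"
    by (intro summable_mult2 summable_K assms)
  have "t * g z - g w = (\<Sum>n. t * (B n * z ^ n) - B n * w ^ n)"
    using suminf_diff[OF summable_mult[OF summable_g[OF assms(1)], of t] summable_g[OF assms(2)]]
      suminf_mult[OF summable_g[OF assms(1)], of t]
    by (simp add: g_def)
  also have "cmod \<dots> \<le> (\<Sum>n. real n * r ^ (n - 1) * cmod (B n) * d)"
  proof (rule norm_suminf_le[OF _ sm])
    fix n
    show "cmod (t * (B n * z ^ n) - B n * w ^ n) \<le> real n * r ^ (n - 1) * cmod (B n) * d"
    proof (cases n)
      case (Suc k)
      have "cmod (t * (B n * z ^ n) - B n * w ^ n) = cmod (B n) * cmod (t * z ^ n - w ^ n)"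
        by (simp add: algebra_simps flip: norm_mult)
      also have "\<dots> \<le> cmod (B n) * (real (Suc k) * r ^ k * d)"
        unfolding Suc by (intro mult_left_mono assms) auto
      finally show ?thesis
        by (simp add: Suc mult_ac)
    qed (simp add: B_0)
  qed
  also have "\<dots> = K r * d"
    unfolding K_def by (intro suminf_mult2[symmetric] summable_K assms)
  finally show ?thesis .
qed

lemma g_lipschitz:
  assumes "cmod z \<le> r" "cmod w \<le> r" "r \<le> 1"
  shows "cmod (g z - g w) \<le> K r * cmod (z - w)"
  using g_diff_le[of z w r 1 "cmod (z - w)"] norm_power_diff_le[OF assms(1,2)] assms
    norm_ge_zero[of z] by (simp del: of_nat_Suc power_Suc)

text \<open>Equal values would force \<open>cmod (z - w) = cmod (g z - g w)\<close>, but
  \<open>g\<close> is a strict contraction on each smaller disc.\<close>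

lemma inj_on_f: "inj_on f unit_disc"
proof (rule inj_onI, rule ccontr)
  fix z w assume zw: "z \<in> unit_disc" "w \<in> unit_disc" "f z = f w" "z \<noteq> w"
  define r where "r = max (cmod z) (cmod w)"
  have "z - w = cnj (g w - g z)"
    using zw(3) by (simp add: f_def algebra_simps)
  then have "cmod (z - w) = cmod (g z - g w)"
    by (metis complex_mod_cnj norm_minus_commute)
  also have "\<dots> \<le> K r * cmod (z - w)"
    using zw by (intro g_lipschitz) (auto simp: r_def)
  also have "\<dots> < 1 * cmod (z - w)"
    using zw by (intro mult_strict_right_mono K_less_1) (auto simp: r_def max_def)
  finally show False
    by simp
qed

lemma f_ray_sphere:
  assumes "f w = of_real t * f z" "cmod z = r" "cmod w = r" "0 < r" "r < 1" "t \<ge> 0"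
  shows "t = 1"
proof (rule ccontr)
  assume t: "t \<noteq> 1"
  \<comment> \<open>Equality would give \<open>t * r = r\<close> on taking moduli.\<close>
  have neq: "of_real t * z \<noteq> w"
    using assms t by (auto simp: norm_mult)
  have "of_real t * z - w = - cnj (of_real t * g z - g w)"
    using assms(1) by (simp add: f_def algebra_simps)
  then have "cmod (of_real t * z - w) = cmod (of_real t * g z - g w)"
    by (metis complex_mod_cnj norm_minus_cancel)
  also have "\<dots> \<le> K r * cmod (of_real t * z - w)"
    using assms norm_scaled_power_diff_le[of z r w t] by (intro g_diff_le) auto
  also have "\<dots> < 1 * cmod (of_real t * z - w)"
    using assms neq by (intro mult_strict_right_mono K_less_1) auto
  finally show False
    by simp
qed

lemma g_has_field_derivative:
  assumes "z \<in> unit_disc"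
  shows "(g has_field_derivative (\<Sum>n. diffs B n * z ^ n)) (at z)"
  unfolding g_def[abs_def] using assms
  by (intro termdiffs_strong'[of 1]) (auto intro: summable_g)

lemma norm_deriv_g_less_1:
  assumes "z \<in> unit_disc"
  shows "cmod (deriv g z) < 1"
proof -
  let ?r = "cmod z"
  have r: "0 \<le> ?r" "?r < 1"
    using assms by auto
  have *: "cmod (diffs B n * z ^ n) = real (Suc n) * ?r ^ (Suc n - 1) * cmod (B (Suc n))" for n
    by (simp add: diffs_def norm_mult norm_power mult_ac del: of_nat_Suc)
  have sm: "summable (\<lambda>n. cmod (diffs B n * z ^ n))"
    unfolding * summable_Suc_iff[of "\<lambda>n. real n * ?r ^ (n - 1) * cmod (B n)"] using r
    by (intro summable_K) auto
  have "cmod (deriv g z) = cmod (\<Sum>n. diffs B n * z ^ n)"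
    using g_has_field_derivative[OF assms] by (simp add: DERIV_imp_deriv)
  also have "\<dots> \<le> (\<Sum>n. cmod (diffs B n * z ^ n))"
    by (rule summable_norm[OF sm])
  also have "\<dots> = K ?r"
    unfolding * K_def using suminf_split_head[OF summable_K[of ?r]] r by simp
  also have "\<dots> < 1"
    using r by (rule K_less_1)
  finally show ?thesis .
qed

lemma holomorphic_on_g: "g holomorphic_on unit_disc"
  using g_has_field_derivative DERIV_subset
  unfolding holomorphic_on_def field_differentiable_def by blast

lemma continuous_on_f: "continuous_on unit_disc f"
  unfolding f_def[abs_def]
  by (intro continuous_intros holomorphic_on_imp_continuous_on holomorphic_on_g)

lemma f_0: "f 0 = 0"
  by (simp add: f_def g_def B_0)

text \<open>Invariance of domain for the continuous injection \<open>f\<close>.\<close>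

lemma open_f_image: "S \<subseteq> unit_disc \<Longrightarrow> open S \<Longrightarrow> open (f ` S)"
  by (meson continuous_on_f continuous_on_subset inj_on_f inj_on_subset invariance_of_domain)

lemma starlike_f_image: "starlike_domain_wrt 0 (f ` unit_disc)"
  unfolding starlike_domain_wrt_def
proof (intro conjI ballI subsetI)
  show "open (f ` unit_disc)" "0 \<in> f ` unit_disc"
    using f_0 by (auto intro!: open_f_image image_eqI[of _ _ 0])
next
  fix w v assume "w \<in> f ` unit_disc" "v \<in> closed_segment 0 w"
  then obtain z t where z: "z \<in> unit_disc" "w = f z" and t: "0 \<le> t" "t \<le> 1" "v = of_real t * w"
    by (auto simp: in_segment scaleR_conv_of_real)
  define r where "r = cmod z"
  let ?K = "f ` cball 0 r"
  have r: "0 \<le> r" "r < 1"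
    using z by (auto simp: r_def)
  have sub: "cball 0 r \<subseteq> unit_disc"
    using r by auto
  show "v \<in> f ` unit_disc"
  proof (rule ccontr)
    assume "v \<notin> f ` unit_disc"
    then have v: "v \<notin> ?K" "v \<noteq> w" "v \<noteq> 0"
      using z sub f_0 by (auto simp: image_iff)
    \<comment> \<open>For \<open>z = 0\<close> also \<open>w = 0\<close>, which contradicts
      \<open>v \<noteq> w\<close> since \<open>v\<close> lies between \<open>0\<close> and
      \<open>w\<close>.\<close>
    have "r > 0"
      using v(2) t z f_0 r by (cases "z = 0") (auto simp: r_def)
    \<comment> \<open>The segment starts in \<open>?K\<close> and ends outside it.\<close>
    have "closed_segment 0 v \<inter> frontier ?K \<noteq> {}"
    proof (rule connected_Int_frontier)
      have "0 \<in> ?K"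
        using f_0 r by (intro image_eqI[of _ _ 0]) auto
      then show "closed_segment 0 v \<inter> ?K \<noteq> {}"
        by auto
      show "closed_segment 0 v - ?K \<noteq> {}"
        using v by auto
    qed auto
    then obtain u where u: "u \<in> closed_segment 0 v" "u \<in> frontier ?K"
      by auto
    \<comment> \<open>Closedness puts \<open>u\<close> in \<open>?K\<close>; the image of the open
      ball is interior, so a preimage of \<open>u\<close> has modulus exactly
      \<open>r\<close>.\<close>
    have "closed ?K"
      by (intro compact_imp_closed compact_continuous_image continuous_on_subset[OF continuous_on_f sub]) auto
    moreover have "f ` ball 0 r \<subseteq> interior ?K"
      using sub by (intro interior_maximal image_mono open_f_image) auto
    ultimately obtain z' where z': "u = f z'" "cmod z' = r"
      using u(2) by (force simp: frontier_def image_iff subset_iff)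
    obtain s where s: "0 \<le> s" "s \<le> 1" "u = of_real s * v"
      using u(1) by (auto simp: in_segment scaleR_conv_of_real)
    have "f z' = of_real (s * t) * f z"
      using s t z z' by simp
    then have "s * t = 1"
      by (rule f_ray_sphere) (use s t z' r \<open>r > 0\<close> in \<open>auto simp: r_def\<close>)
    \<comment> \<open>Both \<open>s\<close> and \<open>t\<close> lie between 0 and 1, so a product
      of 1 forces \<open>t = 1\<close>, hence \<open>v = w\<close>.\<close>
    then have "t = 1"
      using s t by (metis mult_left_le mult_cancel_right2 mult.commute order_antisym)
    then show False
      using t v by simp
  qed
qed

section \<open>Membership in the function classes\<close>

lemma harmonic_decomp_f:
  assumes "\<And>z. z \<in> unit_disc \<Longrightarrow> F z = f z"
  shows "harmonic_decomp F (\<lambda>z. z) g"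
  unfolding harmonic_decomp_def
proof (intro conjI exI ballI)
  show "(\<lambda>n. (if n = 1 then 1 else 0) * z ^ n) sums z" for z :: complex
    using sums_single[of 1 "\<lambda>n. z ^ n"] by (simp add: if_distrib[of "\<lambda>x. x * _"] cong: if_cong)
  show "(\<lambda>n. B n * z ^ n) sums g z" if "z \<in> unit_disc" for z
    using that by (simp add: g_def summable_sums summable_g)
qed (use assms B_0 holomorphic_on_g in \<open>auto simp: f_def\<close>)

lemma in_class_SH:
  assumes "\<And>z. z \<in> unit_disc \<Longrightarrow> F z = f z"
  shows "F \<in> class_SH"
proof -
  have "inj_on F unit_disc"
    using inj_on_f assms by (metis inj_on_cong)
  moreover have "(cmod (deriv (\<lambda>z. z) z))\<^sup>2 - (cmod (deriv g z))\<^sup>2 > 0" if "z \<in> unit_disc" for z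
    using norm_deriv_g_less_1[OF that] by (simp add: power_less_one_iff)
  ultimately show ?thesis
    unfolding class_SH_def class_H_def using harmonic_decomp_f[OF assms] by blast
qed

lemma in_class_CH1:
  assumes "\<And>z. z \<in> unit_disc \<Longrightarrow> F z = f z"
  shows "F \<in> class_CH1"
proof -
  have "Re (deriv (\<lambda>z. z) z) > cmod (cnj (deriv g z))" if "z \<in> unit_disc" for z
    using norm_deriv_g_less_1[OF that] by simp
  then show ?thesis
    unfolding class_CH1_def using in_class_SH[OF assms] harmonic_decomp_f[OF assms] by blast
qed

text \<open>\<open>B 1\<close> is the derivative of \<open>g\<close> at 0, so its vanishing is the
  normalisation of the class.\<close>

lemma in_class_SH_star0:
  assumes "\<And>z. z \<in> unit_disc \<Longrightarrow> F z = f z" and "B 1 = 0"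
  shows "F \<in> class_SH_star0"
proof -
  have "deriv g 0 = 0"
    using DERIV_imp_deriv[OF g_has_field_derivative[of 0]] assms(2)
    by (simp add: diffs_def)
  moreover have "F ` unit_disc = f ` unit_disc"
    using assms(1) by simp
  ultimately show ?thesis
    unfolding class_SH_star0_def
    using in_class_SH[OF assms(1)] harmonic_decomp_f[OF assms(1)] starlike_f_image by auto
qed

end

subsection \<open>Hypergeometric coefficients for admissible parameters\<close>

text \<open>Common interface for the three cases. Multiplication by \<open>z ^ k\<close> shifts the
  coefficients, so \<open>B 1\<close> is \<open>A 0\<close> for \<open>k = 1\<close> and 0 for
  larger \<open>k\<close>.\<close>

lemma shifted_series_classes:
  fixes A :: "nat \<Rightarrow> complex" and F :: "complex \<Rightarrow> complex"
  assumes k: "k \<ge> 1"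
    and A_0: "k = 1 \<Longrightarrow> cmod (A 0) < 1"
    and summable: "summable (\<lambda>n. real (n + k) * cmod (A n))"
    and sum: "(\<Sum>n. real (n + k) * cmod (A n)) \<le> 1"
    and F: "\<And>z. z \<in> unit_disc \<Longrightarrow> F z = z + cnj (z ^ k * (\<Sum>n. A n * z ^ n))"
  shows "F \<in> class_CH1" and "k \<noteq> 1 \<or> A 0 = 0 \<Longrightarrow> F \<in> class_SH_star0"
proof -
  define B where "B n = (if n < k then 0 else A (n - k))" for n
  have B: "B (n + k) = A n" for n
    by (simp add: B_def)
  have "(\<lambda>n. real n * cmod (B n)) sums (\<Sum>n. real (n + k) * cmod (A n))"
    using summable_sums[OF summable] sums_iff_shift[of "\<lambda>n. real n * cmod (B n)" k]
    by (simp add: B) (simp add: B_def)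
  then interpret harmonic_small_coeffs B
    using k A_0 sum by unfold_locales (auto simp: B_def sums_iff)
  have g: "g z = z ^ k * (\<Sum>n. A n * z ^ n)" if "z \<in> unit_disc" for z
  proof -
    have "summable (\<lambda>n. B n * z ^ n)"
      using that by (intro summable_g) auto
    then have "g z = (\<Sum>n. B (n + k) * z ^ (n + k)) + (\<Sum>n<k. B n * z ^ n)"
      unfolding g_def by (rule suminf_split_initial_segment)
    also have "(\<Sum>n<k. B n * z ^ n) = 0"
      by (simp add: B_def)
    finally have g: "g z = (\<Sum>n. z ^ k * (A n * z ^ n))"
      by (simp add: B power_add mult_ac)
    show ?thesis
    \<comment> \<open>Summability of \<open>A n * z ^ n\<close> is recovered by cancelling
      \<open>z ^ k\<close>, which needs \<open>z \<noteq> 0\<close>.\<close>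
    proof (cases "z = 0")
      case False
      have "summable (\<lambda>n. B (n + k) * z ^ (n + k))"
        using \<open>summable (\<lambda>n. B n * z ^ n)\<close> by (rule summable_ignore_initial_segment)
      then have "summable (\<lambda>n. z ^ k * (A n * z ^ n))"
        by (simp add: B power_add mult_ac)
      then show ?thesis
        unfolding g using False by (intro suminf_mult) simp
    qed (use g k in \<open>simp add: power_0_left\<close>)
  qed
  show "F \<in> class_CH1"
    by (rule in_class_CH1) (simp add: F f_def g)
  show "F \<in> class_SH_star0" if "k \<noteq> 1 \<or> A 0 = 0"
    by (rule in_class_SH_star0) (use that k in \<open>auto simp: F f_def g B_def\<close>)
qed

lemma cnj_pochhammer: "cnj (pochhammer a n) = pochhammer (cnj a) n"
  by (simp add: pochhammer_prod)

text \<open>For real parameters the first factors multiply to \<open>a * b > 0\<close> and all later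
  ones are positive, as \<open>a, b > -1\<close>. For conjugate parameters the numerator is a
  squared modulus.\<close>

lemma hyp_coeff_nonneg:
  assumes "admissible_parameters a b" "c > 0"
  shows "hyp_coeff a b (of_real c) n = of_real (cmod (hyp_coeff a b (of_real c) n))"
proof -
  obtain x :: real where x: "pochhammer a n * pochhammer b n = of_real x" "x \<ge> 0"
    using assms(1) unfolding admissible_parameters_def
  proof (elim disjE conjE)
    assume ab: "a \<in> \<real>" "b \<in> \<real>" "Re a > -1" "Re b > -1" "Re (a * b) > 0"
    obtain p q where pq: "a = of_real p" "b = of_real q"
      using ab(1,2) by (auto elim!: Reals_cases)
    have "pochhammer p n * pochhammer q n \<ge> 0"
    proof (cases n)
      case (Suc m)
      have "(p * q) * (pochhammer (p + 1) m * pochhammer (q + 1) m) \<ge> 0"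
        using ab(3-5) pq by (intro mult_nonneg_nonneg[of "p * q"] mult_nonneg_nonneg[of "pochhammer _ _"]
          pochhammer_nonneg) auto
      then show ?thesis
        by (simp add: Suc pochhammer_rec mult_ac)
    qed auto
    then show thesis
      by (rule that[rotated]) (simp add: pq pochhammer_of_real)
  next
    assume "b = cnj a"
    then show thesis
      by (intro that[of "(cmod (pochhammer a n))\<^sup>2"])
         (simp_all only: complex_norm_square cnj_pochhammer zero_le_power2)
  qed
  have "pochhammer c n * pochhammer 1 n > 0"
    using assms(2) by (intro mult_pos_pos pochhammer_pos) auto
  moreover have "hyp_coeff a b (of_real c) n = of_real (x / (pochhammer c n * pochhammer 1 n))"
    using x(1) pochhammer_of_real[of 1 n, where 'a = complex]
    by (simp add: hyp_coeff_def pochhammer_of_real)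
  ultimately show ?thesis
    using x(2) by (metis abs_of_nonneg divide_nonneg_pos norm_of_real)
qed

text \<open>Coefficient form of \<open>F'(a,b;c;z) = (a b / c) F(a+1,b+1;c+1;z)\<close>.\<close>

lemma hyp_coeff_Suc_shift:
  "of_nat (Suc n) * hyp_coeff a b c (Suc n) = a * b / c * hyp_coeff (a + 1) (b + 1) (c + 1) n"
  unfolding hyp_coeff_def pochhammer_fact[symmetric] fact_Suc
    pochhammer_rec[of a] pochhammer_rec[of b] pochhammer_rec[of c]
  by (simp add: divide_simps del: of_nat_Suc)

text \<open>The sum is \<open>F'(1) + k F(1)\<close>, and Gauss's formula evaluates both
  terms.\<close>

lemma sums_hyp_coeff:
  fixes a b :: complex and c :: real
  assumes "c > 0" "c > Re (a + b) + 1"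
  shows "(\<lambda>n. of_nat (n + k) * hyp_coeff a b c n) sums
           (gamma_quotient a b c * (a * b + of_nat k * (c - a - b - 1)))"
proof -
  let ?c = "complex_of_real c"
  have c: "?c \<notin> \<int>\<^sub>\<le>\<^sub>0" "?c + 1 \<notin> \<int>\<^sub>\<le>\<^sub>0" "?c - a - b - 1 \<notin> \<int>\<^sub>\<le>\<^sub>0" "c \<noteq> 0"
    using assms by (auto intro!: Re_pos_imp_not_nonpos_Int)
  have "Gamma (?c - a - b) = (?c - a - b - 1) * Gamma (?c - a - b - 1)"
    using Gamma_plus1[OF c(3)] by simp
  then have "hyp2F1 a b ?c 1 = gamma_quotient a b c * (?c - a - b - 1)"
    using Gauss_hyp2F1_1[OF c(1), of a b] assms(2) by (simp add: gamma_quotient_def)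
  moreover have "hyp_coeff a b ?c sums hyp2F1 a b ?c 1"
    using summable_norm_cancel[OF summable_norm_hyp_coeff[OF c(1), of a b]] assms(2)
    by (simp add: hyp2F1_eq summable_sums)
  ultimately have s0: "hyp_coeff a b ?c sums (gamma_quotient a b c * (?c - a - b - 1))"
    by simp
  \<comment> \<open>The shift preserves \<open>c - a\<close> and \<open>c - b\<close> and turns
    \<open>c - a - b\<close> into \<open>c - a - b - 1\<close>, so \<open>c > Re (a + b) + 1\<close>
    is exactly the convergence condition.\<close>
  have "hyp2F1 (a + 1) (b + 1) (?c + 1) 1 = ?c * gamma_quotient a b c"
    using Gauss_hyp2F1_1[OF c(2), of "a + 1" "b + 1"] assms(2) Gamma_plus1[OF c(1)]
    by (simp add: gamma_quotient_def algebra_simps)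
  moreover have "hyp_coeff (a + 1) (b + 1) (?c + 1) sums hyp2F1 (a + 1) (b + 1) (?c + 1) 1"
    using summable_norm_cancel[OF summable_norm_hyp_coeff[OF c(2), of "a + 1" "b + 1"]] assms(2)
    by (simp add: hyp2F1_eq summable_sums)
  ultimately have "(\<lambda>n. of_nat (Suc n) * hyp_coeff a b ?c (Suc n)) sums
      (a * b / ?c * (?c * gamma_quotient a b c))"
    unfolding hyp_coeff_Suc_shift by (intro sums_mult) simp
  then have s1: "(\<lambda>n. of_nat n * hyp_coeff a b ?c n) sums (gamma_quotient a b c * (a * b))"
    using c(4) sums_Suc_iff[of "\<lambda>n. of_nat n * hyp_coeff a b ?c n"] by (simp add: mult_ac)
  show ?thesis
    using sums_add[OF s1 sums_mult[OF s0, of "of_nat k"]] by (simp add: algebra_simps)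
qed

lemma sums_norm_hyp_coeff:
  fixes a b :: complex and c :: real
  assumes "admissible_parameters a b" "c > 0" "c > Re (a + b) + 1"
  shows "(\<lambda>n. real (n + k) * cmod (hyp_coeff a b c n)) sums
           Re (gamma_quotient a b c * (a * b + of_nat k * (c - a - b - 1)))"
proof -
  have "(\<lambda>n. Re (of_nat (n + k) * hyp_coeff a b c n)) sums
           Re (gamma_quotient a b c * (a * b + of_nat k * (c - a - b - 1)))"
    using assms by (intro sums_Re sums_hyp_coeff)
  moreover have "Re (of_nat (n + k) * hyp_coeff a b c n) = real (n + k) * cmod (hyp_coeff a b c n)" for n
    by (subst hyp_coeff_nonneg[OF assms(1,2)]) (simp flip: of_nat_add)
  ultimately show ?thesis
    by (simp only:)
qed

theorem theorem5:
  fixes a b \<alpha> :: complex and c :: real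
  assumes "admissible_parameters a b"
    and "c > 0"
    and "c > Re (a + b) + 1"
  shows
    "(0 < cmod \<alpha> \<and> cmod \<alpha> < 1 / 2 \<and>
        Re (gamma_quotient a b c * (a * b + 2 * (c - a - b - 1))) \<le> 1 / cmod \<alpha>
      \<longrightarrow> (\<lambda>z. z + cnj (\<alpha> * z ^ 2 * hyp2F1 a b c z)) \<in> class_SH_star0 \<inter> class_CH1)
   \<and> (2 * cmod \<alpha> * Re (a * b) \<le> c \<and>
        Re (gamma_quotient a b c * (a * b + c - a - b - 1)) \<le> (1 + cmod \<alpha>) / cmod \<alpha>
      \<longrightarrow> (\<lambda>z. z + cnj (\<alpha> * z * (hyp2F1 a b c z - 1))) \<in> class_SH_star0 \<inter> class_CH1)
   \<and> (0 < cmod \<alpha> \<and> cmod \<alpha> < 1 \<and>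
        Re (gamma_quotient a b c * (a * b + c - a - b - 1)) \<le> 1 / cmod \<alpha>
      \<longrightarrow> (\<lambda>z. z + cnj (\<alpha> * z ^ 1 * hyp2F1 a b c z)) \<in> class_CH1)"
proof -
  let ?A = "hyp_coeff a b c"
  \<comment> \<open>The sum of the coefficient moduli with weights \<open>n + k\<close>:
    \<open>Q 2\<close> is the quantity in (a), \<open>Q 1\<close> the one in (b) and (c).\<close>
  define Q where "Q k = Re (gamma_quotient a b c * (a * b + of_nat k * (c - a - b - 1)))" for k :: nat
  have s: "(\<lambda>n. real (n + k) * cmod (?A n)) sums Q k" for k
    unfolding Q_def by (rule sums_norm_hyp_coeff[OF assms])
  have s\<alpha>: "(\<lambda>n. real (n + k) * cmod (\<alpha> * ?A n)) sums (cmod \<alpha> * Q k)" for k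
    using sums_mult[OF s[of k], of "cmod \<alpha>"] by (simp only: norm_mult mult.left_commute)
  have summable_A: "summable (\<lambda>n. ?A n * z ^ n)" if "z \<in> unit_disc" for z
  proof -
    have "summable (\<lambda>n. cmod (?A n))"
      using assms by (intro summable_norm_hyp_coeff Re_pos_imp_not_nonpos_Int) auto
    then show ?thesis
      by (rule summable_comparison_test[rotated], intro exI allI impI)
        (use that in \<open>auto simp: norm_mult norm_power intro!: mult_left_le power_le_one\<close>)
  qed
  have F: "\<alpha> * hyp2F1 a b c z = (\<Sum>n. \<alpha> * ?A n * z ^ n)" if "z \<in> unit_disc" for z
    using suminf_mult[OF summable_A[OF that], of \<alpha>] by (simp add: hyp2F1_eq mult.assoc)
  have "a * b + of_nat 1 * (c - a - b - 1) = a * b + c - a - b - 1"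
    by simp
  then have Q1: "Re (gamma_quotient a b c * (a * b + c - a - b - 1)) = Q 1"
    unfolding Q_def by (simp only:)
  have Q2: "Re (gamma_quotient a b c * (a * b + 2 * (c - a - b - 1))) = Q 2"
    unfolding Q_def by (simp only: of_nat_numeral)

  have "(\<lambda>z. z + cnj (\<alpha> * z ^ 2 * hyp2F1 a b c z)) \<in> class_SH_star0 \<inter> class_CH1"
    if "0 < cmod \<alpha>" "Q 2 \<le> 1 / cmod \<alpha>"
  proof -
    have "cmod \<alpha> * Q 2 \<le> 1"
      using that by (simp add: field_simps)
    then have sum: "(\<Sum>n. real (n + 2) * cmod (\<alpha> * ?A n)) \<le> 1"
      by (simp only: sums_unique[OF s\<alpha>, symmetric])
    have "z + cnj (\<alpha> * z ^ 2 * hyp2F1 a b c z) = z + cnj (z ^ 2 * (\<Sum>n. \<alpha> * ?A n * z ^ n))"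
      if "z \<in> unit_disc" for z
      unfolding F[OF that, symmetric] by (simp add: mult_ac)
    note * = shifted_series_classes[of 2 "\<lambda>n. \<alpha> * ?A n", OF _ _ sums_summable[OF s\<alpha>] sum this]
    show ?thesis
      by (intro IntI *) auto
  qed
  moreover have "(\<lambda>z. z + cnj (\<alpha> * z * (hyp2F1 a b c z - 1))) \<in> class_SH_star0 \<inter> class_CH1"
    if Q: "Q 1 \<le> (1 + cmod \<alpha>) / cmod \<alpha>"
  proof -
    let ?A' = "\<lambda>n. if n = 0 then 0 else \<alpha> * ?A n"
    \<comment> \<open>Subtracting 1 from the hypergeometric function deletes the term at
      \<open>n = 0\<close>, which contributes \<open>cmod \<alpha>\<close> with weight 1.\<close>
    have "(\<lambda>n. real (n + 1) * cmod (?A' n)) sums (cmod \<alpha> * Q 1 - cmod \<alpha>)"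
      using sums_diff[OF s\<alpha>[of 1] sums_single[of 0 "\<lambda>_. cmod \<alpha>"]]
      by (rule sums_cong[THEN iffD1, rotated]) auto
    then have summable: "summable (\<lambda>n. real (n + 1) * cmod (?A' n))"
      and sum: "(\<Sum>n. real (n + 1) * cmod (?A' n)) = cmod \<alpha> * Q 1 - cmod \<alpha>"
      by (simp_all only: sums_iff)
    have "cmod \<alpha> * Q 1 - cmod \<alpha> \<le> 1"
      using Q by (cases "\<alpha> = 0") (auto simp: field_simps)
    then have le: "(\<Sum>n. real (n + 1) * cmod (?A' n)) \<le> 1"
      by (simp only: sum)
    have "z + cnj (\<alpha> * z * (hyp2F1 a b c z - 1)) = z + cnj (z ^ 1 * (\<Sum>n. ?A' n * z ^ n))"
      if "z \<in> unit_disc" for z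
    proof -
      have "(\<lambda>n. \<alpha> * (?A n * z ^ n)) sums (\<alpha> * hyp2F1 a b c z)"
        unfolding hyp2F1_eq by (intro sums_mult summable_sums summable_A that)
      then have "(\<lambda>n. \<alpha> * (?A n * z ^ n) - (if n = 0 then \<alpha> else 0)) sums (\<alpha> * hyp2F1 a b c z - \<alpha>)"
        by (intro sums_diff sums_single)
      then have "(\<lambda>n. ?A' n * z ^ n) sums (\<alpha> * hyp2F1 a b c z - \<alpha>)"
        by (rule sums_cong[THEN iffD1, rotated]) auto
      then have "(\<Sum>n. ?A' n * z ^ n) = \<alpha> * (hyp2F1 a b c z - 1)"
        by (simp only: sums_iff right_diff_distrib mult_1_right)
      then show ?thesis
        by (simp only: power_one_right mult_ac)
    qed
    note * = shifted_series_classes[of 1 ?A', OF _ _ summable le this]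
    show ?thesis
      by (intro IntI *) auto
  qed
  moreover have "(\<lambda>z. z + cnj (\<alpha> * z ^ 1 * hyp2F1 a b c z)) \<in> class_CH1"
    if "0 < cmod \<alpha>" "cmod \<alpha> < 1" "Q 1 \<le> 1 / cmod \<alpha>"
  proof -
    have "cmod \<alpha> * Q 1 \<le> 1"
      using that by (simp add: field_simps)
    then have sum: "(\<Sum>n. real (n + 1) * cmod (\<alpha> * ?A n)) \<le> 1"
      by (simp only: sums_unique[OF s\<alpha>, symmetric])
    have "z + cnj (\<alpha> * z ^ 1 * hyp2F1 a b c z) = z + cnj (z ^ 1 * (\<Sum>n. \<alpha> * ?A n * z ^ n))"
      if "z \<in> unit_disc" for z
      unfolding F[OF that, symmetric] by (simp add: mult_ac)
    note * = shifted_series_classes(1)[of 1 "\<lambda>n. \<alpha> * ?A n", OF _ _ sums_summable[OF s\<alpha>] sum this]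
    show ?thesis
      \<comment> \<open>Here the coefficient of \<open>z\<close> in the co-analytic part is \<alpha>
        itself, so \<open>cmod \<alpha> < 1\<close> supplies the strict bound.\<close>
      by (rule *) (use that(2) in auto)
  qed
  ultimately show ?thesis
    unfolding Q1 Q2 by blast
qed

end
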